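(* Let $d\ge1$ and $n_1,\dots,n_d\ge1$. Let $M$ be a symmetric $N\times N$ matrix over $\mathbb{F}_2$, $N=n_1\cdots n_d$, indexed by the vertices $(j_1,\dots,j_d)$, $1\le j_i\le n_i$, of the $n_1\times\cdots\times n_d$ grid, all of whose diagonal entries equal $1$ (a $\sigma^+$-game), and assume that $M$ commutes with $I_{n_1}\otimes\cdots\otimes I_{n_{i-1}}\otimes J_{n_i}\otimes I_{n_{i+1}}\otimes\cdots\otimes I_{n_d}$ for every $i=1,\dots,d$. Then every completely symmetric configuration lies in the image of $M$, i.e. can be achieved starting from the all-off configuration.
   Context: $J_n$ is the $n\times n$ matrix over $\mathbb{F}_2$ with $1$'s directly above and below the diagonal and $0$'s elsewhere. A configuration is a vector $y=(y_{j_1,\dots,j_d})\in\mathbb{F}_2^{N}$; pushing a vertex adds the corresponding column of $M$. A configuration is completely symmetric if $y_{j_1,\dots,j_{i-1},j_i,j_{i+1},\dots,j_d}=y_{j_1,\dots,j_{i-1},n_i+1-j_i,j_{i+1},\dots,j_d}$ for all $i$ and all $j_1,\dots,j_d$. *)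

theory Defs
  imports Main "HOL-Library.FuncSet" "HOL-Library.Z2"
begin

text \<open>Matrices and vectors over \<^typ>\<open>bit\<close> (the field with two elements) are indexed by
  arbitrary finite sets \<open>V\<close>; only the entries at indices in \<open>V\<close> are meaningful. Operations
  return extensional functions, so that equality of results means agreement on \<open>V\<close>.\<close>

type_synonym 'v bit_matrix = "'v \<Rightarrow> 'v \<Rightarrow> bit"

definition matrix_mult :: "'v set \<Rightarrow> 'v bit_matrix \<Rightarrow> 'v bit_matrix \<Rightarrow> 'v bit_matrix" where
  "matrix_mult V A B = (\<lambda>u\<in>V. \<lambda>v\<in>V. \<Sum>w\<in>V. A u w * B w v)"

definition matrix_vec :: "'v set \<Rightarrow> 'v bit_matrix \<Rightarrow> ('v \<Rightarrow> bit) \<Rightarrow> ('v \<Rightarrow> bit)" where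
  "matrix_vec V A x = (\<lambda>u\<in>V. \<Sum>v\<in>V. A u v * x v)"

definition commute_on :: "'v set \<Rightarrow> 'v bit_matrix \<Rightarrow> 'v bit_matrix \<Rightarrow> bool" where
  "commute_on V A B \<longleftrightarrow> matrix_mult V A B = matrix_mult V B A"

definition symmetric_on :: "'v set \<Rightarrow> 'v bit_matrix \<Rightarrow> bool" where
  "symmetric_on V A \<longleftrightarrow> (\<forall>u\<in>V. \<forall>v\<in>V. A u v = A v u)"

definition configurations :: "'v set \<Rightarrow> ('v \<Rightarrow> bit) set" where
  "configurations V = V \<rightarrow>\<^sub>E UNIV"

definition matrix_image :: "'v set \<Rightarrow> 'v bit_matrix \<Rightarrow> ('v \<Rightarrow> bit) set" where
  "matrix_image V A = matrix_vec V A ` configurations V"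

definition all_off :: "'v set \<Rightarrow> 'v \<Rightarrow> bit" where
  "all_off V = (\<lambda>v\<in>V. 0)"

definition push :: "'v set \<Rightarrow> 'v bit_matrix \<Rightarrow> 'v \<Rightarrow> ('v \<Rightarrow> bit) \<Rightarrow> ('v \<Rightarrow> bit)" where
  "push V A p y = (\<lambda>v\<in>V. y v + A v p)"

definition achievable :: "'v set \<Rightarrow> 'v bit_matrix \<Rightarrow> ('v \<Rightarrow> bit) set" where
  "achievable V A = {fold (push V A) ps (all_off V) | ps. set ps \<subseteq> V}"

definition grid :: "nat \<Rightarrow> (nat \<Rightarrow> nat) \<Rightarrow> (nat \<Rightarrow> nat) set" where
  "grid d n = (\<Pi>\<^sub>E i\<in>{1..d}. {1..n i})"

definition id_matrix :: "nat \<Rightarrow> nat bit_matrix" where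
  "id_matrix m = (\<lambda>r\<in>{1..m}. \<lambda>c\<in>{1..m}. of_bool (r = c))"

definition J_matrix :: "nat \<Rightarrow> nat bit_matrix" where
  "J_matrix m = (\<lambda>r\<in>{1..m}. \<lambda>c\<in>{1..m}. of_bool (r = c + 1 \<or> c = r + 1))"

text \<open>The Kronecker product \<open>A 1 \<otimes> \<dots> \<otimes> A d\<close>, with rows and columns indexed by multi-indices.\<close>

definition kronecker :: "nat \<Rightarrow> (nat \<Rightarrow> nat bit_matrix) \<Rightarrow> (nat \<Rightarrow> nat) bit_matrix" where
  "kronecker d A = (\<lambda>u v. \<Prod>k\<in>{1..d}. A k (u k) (v k))"

definition J_factor :: "nat \<Rightarrow> (nat \<Rightarrow> nat) \<Rightarrow> nat \<Rightarrow> (nat \<Rightarrow> nat) bit_matrix" where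
  "J_factor d n i = kronecker d (\<lambda>k. if k = i then J_matrix (n k) else id_matrix (n k))"

definition completely_symmetric ::
    "nat \<Rightarrow> (nat \<Rightarrow> nat) \<Rightarrow> ((nat \<Rightarrow> nat) \<Rightarrow> bit) \<Rightarrow> bool" where
  "completely_symmetric d n y \<longleftrightarrow>
     (\<forall>i\<in>{1..d}. \<forall>j\<in>grid d n. y j = y (j(i := n i + 1 - j i)))"

end

theory Submission
  imports Defs
begin

text \<open>Sutner's theorem puts the all-ones configuration into the image of \<open>M\<close>. As \<open>M\<close> commutes
  with the operators \<open>J\<^sub>i\<close> (the matrix \<open>J\<close> acting on the \<open>i\<close>-th coordinate), its image is
  closed under the algebra they generate. In one dimension this algebra maps the all-ones vector
  onto all symmetric vectors, and treating one coordinate after the other yields all completely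
  symmetric configurations.\<close>

lemma bit_add_self [simp]: "(x::bit) + x = 0"
  by (cases x) simp_all

text \<open>These rules would replace sums and products of bits by \<^const>\<open>of_bool\<close> terms.\<close>

declare add_bit_eq_xor [simp del] mult_bit_eq_and [simp del]

section \<open>Images of matrices over the two-element field\<close>

lemma matrix_vec_in_image: "matrix_vec V A x \<in> matrix_image V A"
proof -
  have "matrix_vec V A x = matrix_vec V A (restrict x V)"
    unfolding matrix_vec_def by (intro restrict_ext sum.cong) auto
  moreover have "restrict x V \<in> configurations V"
    by (auto simp: configurations_def)
  ultimately show ?thesis
    unfolding matrix_image_def by blast
qed

lemma matrix_image_add:
  assumes "restrict x V \<in> matrix_image V A" "restrict y V \<in> matrix_image V A"
  shows "(\<lambda>v\<in>V. x v + y v) \<in> matrix_image V A"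
proof -
  obtain p q where p: "restrict x V = matrix_vec V A p" and q: "restrict y V = matrix_vec V A q"
    using assms by (auto simp: matrix_image_def)
  have "(\<lambda>v\<in>V. x v + y v) = (\<lambda>v\<in>V. restrict x V v + restrict y V v)"
    by (intro restrict_ext) simp
  also have "\<dots> = matrix_vec V A (\<lambda>v. p v + q v)"
    unfolding p q matrix_vec_def
    by (intro restrict_ext) (simp only: restrict_apply' distrib_left sum.distrib)
  finally show ?thesis
    by (simp add: matrix_vec_in_image)
qed

lemma matrix_vec_mult:
  "matrix_vec V (matrix_mult V A B) x = matrix_vec V A (matrix_vec V B x)"
proof -
  have "(\<Sum>v\<in>V. (\<Sum>w\<in>V. A u w * B w v) * x v) = (\<Sum>w\<in>V. A u w * (\<Sum>v\<in>V. B w v * x v))" for u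
    unfolding sum_distrib_left sum_distrib_right
    by (subst sum.swap) (simp add: mult.assoc)
  then show ?thesis
    unfolding matrix_vec_def matrix_mult_def by (intro restrict_ext) simp
qed

text \<open>With \<open>x = A z\<close>, commutation gives \<open>B x = A (B z)\<close>.\<close>

lemma matrix_image_commute:
  assumes "commute_on V A B" "x \<in> matrix_image V A"
  shows "matrix_vec V B x \<in> matrix_image V A"
proof -
  obtain z where "x = matrix_vec V A z"
    using assms(2) by (auto simp: matrix_image_def)
  then have "matrix_vec V B x = matrix_vec V A (matrix_vec V B z)"
    using assms(1) by (simp add: commute_on_def flip: matrix_vec_mult)
  then show ?thesis
    by (simp add: matrix_vec_in_image)
qed

section \<open>Solvability of the all-ones configuration\<close>

text \<open>Off-diagonal entries come in pairs \<open>A u v = A v u\<close> that cancel in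
  characteristic two, so only the trace remains.\<close>

lemma sum_symmetric_matrix:
  assumes "finite V" "symmetric_on V A"
  shows "(\<Sum>u\<in>V. \<Sum>v\<in>V. A u v) = (\<Sum>u\<in>V. A u u)"
  using assms
proof (induction V rule: finite_induct)
  case (insert a V)
  have "(\<Sum>u\<in>V. A u a) = (\<Sum>u\<in>V. A a u)"
    using insert.prems unfolding symmetric_on_def by (intro sum.cong) blast+
  moreover have "(\<Sum>u\<in>V. \<Sum>v\<in>V. A u v) = (\<Sum>u\<in>V. A u u)"
    using insert.prems unfolding symmetric_on_def by (intro insert.IH[unfolded symmetric_on_def]) blast
  ultimately show ?case
    using insert.hyps by (simp add: sum.distrib ac_simps)
qed simp

text \<open>This is Sutner's theorem. Solutions \<open>Y v\<close> for the subgames on \<open>V - {v}\<close> either solve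
  the game on \<open>V\<close> already, or each \<open>Y v\<close> lights all of \<open>V\<close> except \<open>v\<close>. In the latter case
  the combination with coefficients \<open>c\<close> lights \<open>u\<close> precisely if \<open>c u + (\<Sum>v\<in>V. c v) = 1\<close>.\<close>

lemma all_ones_solvable:
  assumes "finite V" "symmetric_on V A" "\<forall>v\<in>V. A v v = 1"
  shows "\<exists>x. \<forall>u\<in>V. (\<Sum>w\<in>V. A u w * x w) = 1"
  using assms
proof (induction V rule: finite_psubset_induct)
  case (psubset V)
  have "\<exists>x. \<forall>u\<in>V - {v}. (\<Sum>w\<in>V. A u w * x w) = 1" if "v \<in> V" for v
  proof -
    have "\<exists>x. \<forall>u\<in>V - {v}. (\<Sum>w\<in>V - {v}. A u w * x w) = 1"
      using psubset.prems that by (intro psubset.IH) (auto simp: symmetric_on_def)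
    then obtain x where "\<forall>u\<in>V - {v}. (\<Sum>w\<in>V - {v}. A u w * x w) = 1" ..
    \<comment> \<open>Leaving \<open>v\<close> unpushed extends the solution of the subgame to
      \<open>V\<close>; only the light at \<open>v\<close> is uncontrolled.\<close>
    then have "\<forall>u\<in>V - {v}. (\<Sum>w\<in>V. A u w * (x(v := 0)) w) = 1"
      using psubset.hyps that by (simp add: sum.remove[of V v])
    then show ?thesis by blast
  qed
  then obtain Y where Y: "\<And>u v. v \<in> V \<Longrightarrow> u \<in> V - {v} \<Longrightarrow> (\<Sum>w\<in>V. A u w * Y v w) = 1"
    by metis
  show ?case
  proof (cases "\<exists>v\<in>V. (\<Sum>w\<in>V. A v w * Y v w) = 1")
    case True
    then obtain v where "v \<in> V" "(\<Sum>w\<in>V. A v w * Y v w) = 1" by blast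
    with Y[of v] show ?thesis by (intro exI[of _ "Y v"]) auto
  next
    case False
    then have AY: "(\<Sum>w\<in>V. A u w * Y v w) = 1 + of_bool (u = v)" if "u \<in> V" "v \<in> V" for u v
      using Y[of v u] that by (cases "u = v") auto
    have comb: "(\<Sum>w\<in>V. A u w * (\<Sum>v\<in>V. c v * Y v w)) = (\<Sum>v\<in>V. c v) + c u" if "u \<in> V" for c u
    proof -
      have "(\<Sum>w\<in>V. A u w * (\<Sum>v\<in>V. c v * Y v w)) = (\<Sum>v\<in>V. c v * (\<Sum>w\<in>V. A u w * Y v w))"
        unfolding sum_distrib_left by (subst sum.swap) (simp add: ac_simps)
      also have "\<dots> = (\<Sum>v\<in>V. c v + (if u = v then c v else 0))"
        using that by (intro sum.cong) (auto simp: AY)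
      also have "\<dots> = (\<Sum>v\<in>V. c v) + c u"
        using that psubset.hyps by (simp add: sum.distrib)
      finally show ?thesis .
    qed
    show ?thesis
    \<comment> \<open>This sum is the parity of the size of \<open>V\<close>. If it is even, taking
      all coefficients \<open>c\<close> to be 1 suffices.\<close>
    proof (cases "(\<Sum>v\<in>V. 1 :: bit) = 0")
      case True
      then show ?thesis
        using comb[of _ "\<lambda>_. 1"] by (intro exI[of _ "\<lambda>w. \<Sum>v\<in>V. 1 * Y v w"]) simp
    next
      case False
      \<comment> \<open>The sum of all entries equals the trace, hence the parity of the size of
        \<open>V\<close>, which is odd; so some row \<open>p\<close> has an odd sum.\<close>
      have "(\<Sum>u\<in>V. \<Sum>v\<in>V. A u v) = (\<Sum>v\<in>V. 1)"
        using psubset.prems psubset.hyps by (simp add: sum_symmetric_matrix)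
      with False have "(\<Sum>u\<in>V. \<Sum>v\<in>V. A u v) \<noteq> 0"
        by argo
      then obtain p where p: "p \<in> V" "(\<Sum>v\<in>V. A p v) \<noteq> 0"
        by (rule sum.not_neutral_contains_not_neutral)
      \<comment> \<open>Pushing \<open>p\<close> in addition contributes
        \<open>A u p = A p u\<close>, which \<open>c u\<close> complements to 1. As the row sum and
        the size of \<open>V\<close> are both odd, the \<open>c v\<close> sum to 0.\<close>
      define c where "c v = 1 + A p v" for v
      have c0: "(\<Sum>v\<in>V. c v) = 0"
      proof -
        have "(\<Sum>v\<in>V. 1 :: bit) = 1" "(\<Sum>v\<in>V. A p v) = 1"
          using p False by (simp_all only: bit_not_zero_iff)
        then show ?thesis
          by (simp only: c_def sum.distrib bit_add_self)
      qed
      show ?thesis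
      proof (intro exI[of _ "\<lambda>w. (\<Sum>v\<in>V. c v * Y v w) + of_bool (w = p)"] ballI)
        fix u assume u: "u \<in> V"
        have "(\<Sum>w\<in>V. A u w * of_bool (w = p)) = A u p"
          using p psubset.hyps by (simp add: of_bool_def if_distrib[of "(*) _"] cong: if_cong)
        moreover have "A u p = A p u"
          using u p psubset.prems unfolding symmetric_on_def by blast
        ultimately show "(\<Sum>w\<in>V. A u w * ((\<Sum>v\<in>V. c v * Y v w) + of_bool (w = p))) = 1"
          using comb[OF u, of c] c0
          by (simp add: distrib_left sum.distrib c_def add.assoc)
      qed
    qed
  qed
qed

text \<open>Pushing each vertex with \<open>x v = 1\<close> once, in any order, produces the
  configuration \<open>A x\<close>.\<close>

lemma matrix_image_subset_achievable:
  assumes "finite V"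
  shows "matrix_image V A \<subseteq> achievable V A"
proof
  fix y assume "y \<in> matrix_image V A"
  then obtain x where x: "y = matrix_vec V A x" by (auto simp: matrix_image_def)
  obtain ps where ps: "set ps = {v \<in> V. x v = 1}" "distinct ps"
    using assms finite_distinct_list[of "{v \<in> V. x v = 1}"] by auto
  have fold_push: "fold (push V A) ps (restrict z V) = (\<lambda>v\<in>V. z v + (\<Sum>p\<leftarrow>ps. A v p))" for ps z
  proof (induction ps arbitrary: z)
    case (Cons p ps)
    have "push V A p (restrict z V) = (\<lambda>v\<in>V. z v + A v p)"
      unfolding push_def by (intro restrict_ext) simp
    then show ?case
      by (simp only: fold_simps comp_apply Cons.IH list.map sum_list.Cons add.assoc)
  qed simp
  have "y = (\<lambda>v\<in>V. 0 + (\<Sum>p\<leftarrow>ps. A v p))"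
    unfolding x matrix_vec_def
  proof (intro restrict_ext)
    fix u assume "u \<in> V"
    have "(\<Sum>v\<in>V. A u v * x v) = (\<Sum>v\<in>V. if x v = 1 then A u v else 0)"
      by (intro sum.cong) auto
    also have "\<dots> = (\<Sum>v\<in>set ps. A u v)"
      using assms unfolding ps by (simp add: sum.inter_filter)
    finally show "(\<Sum>v\<in>V. A u v * x v) = 0 + (\<Sum>p\<leftarrow>ps. A u p)"
      using ps(2) by (simp add: sum_list_distinct_conv_sum_set)
  qed
  also have "\<dots> = fold (push V A) ps (all_off V)"
    unfolding all_off_def fold_push ..
  finally show "y \<in> achievable V A"
    using ps(1) by (auto simp: achievable_def)
qed

section \<open>The operators \<open>J\<close> on the coordinates of the grid\<close>

lemma finite_grid: "finite (grid d n)"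
  by (auto simp: grid_def intro: finite_PiE)

lemma grid_upd:
  assumes "u \<in> grid d n" "i \<in> {1..d}" "r \<in> {1..n i}"
  shows "u(i := r) \<in> grid d n"
  using assms by (auto simp: grid_def PiE_iff extensional_def)

lemma grid_coord: "u \<in> grid d n \<Longrightarrow> i \<in> {1..d} \<Longrightarrow> u i \<in> {1..n i}"
  by (auto simp: grid_def PiE_iff)

text \<open>An identity factor kills the entry at \<open>u\<close>, \<open>v\<close> if they differ
  in a coordinate other than \<open>i\<close>, so only the line through \<open>u\<close> in
  direction \<open>i\<close> contributes.\<close>

lemma matrix_vec_J_factor:
  assumes u: "u \<in> grid d n" and i: "i \<in> {1..d}"
  shows "matrix_vec (grid d n) (J_factor d n i) x u =
         (\<Sum>r\<in>{1..n i}. J_matrix (n i) (u i) r * x (u(i := r)))"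
proof -
  let ?J = "J_factor d n i" and ?L = "(\<lambda>r. u(i := r)) ` {1..n i}"
  have J0: "?J u v = 0" if v: "v \<in> grid d n - ?L" for v
  proof -
    have "v \<noteq> u(i := v i)"
      using v i grid_coord[of v d n i] by auto
    then obtain k where k: "k \<noteq> i" "v k \<noteq> u k"
      by (auto simp: fun_eq_iff split: if_splits)
    \<comment> \<open>Points of the grid agree outside \<open>{1..d}\<close>, being extensional, so
      \<open>k\<close> is a true coordinate.\<close>
    then have kd: "k \<in> {1..d}"
      using u v by (auto simp: grid_def PiE_iff extensional_def)
    have "id_matrix (n k) (u k) (v k) = 0"
      using k grid_coord[OF u kd] grid_coord[of v d n k] v kd by (simp add: id_matrix_def)
    then show ?thesis
      using kd k unfolding J_factor_def kronecker_def by (intro prod_zero) (auto intro!: bexI[of _ k])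
  qed
  have J1: "?J u (u(i := r)) = J_matrix (n i) (u i) r" for r
  proof -
    have "(\<Prod>k\<in>{1..d} - {i}. (if k = i then J_matrix (n k) else id_matrix (n k)) (u k) ((u(i := r)) k)) = 1"
      using grid_coord[OF u] by (intro prod.neutral) (auto simp: id_matrix_def)
    then show ?thesis
      using i unfolding J_factor_def kronecker_def by (subst prod.remove[of _ i]) simp_all
  qed
  have inj: "inj_on (\<lambda>r. u(i := r)) {1..n i}"
    by (auto simp: inj_on_def fun_eq_iff split: if_splits)
  have "matrix_vec (grid d n) ?J x u = (\<Sum>v\<in>grid d n. ?J u v * x v)"
    using u by (simp add: matrix_vec_def)
  also have "\<dots> = (\<Sum>v\<in>?L. ?J u v * x v)"
    using J0 grid_upd[OF u i] by (intro sum.mono_neutral_right finite_grid) auto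
  also have "\<dots> = (\<Sum>r\<in>{1..n i}. J_matrix (n i) (u i) r * x (u(i := r)))"
    by (simp only: sum.reindex[OF inj] J1 o_def)
  finally show ?thesis .
qed

section \<open>Symmetric vectors in one dimension\<close>

lemma matrix_vec_J_matrix:
  assumes r: "r \<in> {1..m}"
  shows "matrix_vec {1..m} (J_matrix m) f r =
         (if 2 \<le> r then f (r - 1) else 0) + (if r < m then f (r + 1) else 0)"
proof -
  have entry: "J_matrix m r c * f c =
      (if c = r - 1 \<and> 2 \<le> r then f c else 0) + (if c = r + 1 then f c else 0)"
    if c: "c \<in> {1..m}" for c
  proof -
    have "J_matrix m r c = of_bool (r = c + 1 \<or> c = r + 1)"
      using r c by (simp add: J_matrix_def)
    moreover have "r = c + 1 \<longleftrightarrow> c = r - 1 \<and> 2 \<le> r"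
      using c by auto
    moreover have "\<not> (r = c + 1 \<and> c = r + 1)"
      by simp
    ultimately show ?thesis by (smt (verit) add_0 add_0_right mult_1 mult_zero_left of_bool_eq)
  qed
  have "matrix_vec {1..m} (J_matrix m) f r =
        (\<Sum>c\<in>{1..m}. (if c = r - 1 \<and> 2 \<le> r then f c else 0) + (if c = r + 1 then f c else 0))"
    using r entry by (simp add: matrix_vec_def)
  also have "\<dots> = (\<Sum>c\<in>{1..m}. if c = r - 1 \<and> 2 \<le> r then f c else 0) + (if r < m then f (r + 1) else 0)"
    using r by (auto simp: sum.distrib)
  also have "(\<Sum>c\<in>{1..m}. if c = r - 1 \<and> 2 \<le> r then f c else 0) = (if 2 \<le> r then f (r - 1) else 0)"
    using r by auto
  finally show ?thesis .
qed

text \<open>Let \<open>g j = e\<^sub>j + e\<^bsub>m + 1 - j\<^esub>\<close>, so that \<open>g 0\<close> vanishes on \<open>{1..m}\<close>. Then \<open>g 1\<close> is the image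
  of the all-ones vector under \<open>J\<close>, and \<open>g (j + 1) = J (g j) + g (j - 1)\<close>. The \<open>g j\<close> vanish at the
  middle index of an odd \<open>m\<close>, which is why the all-ones vector is needed once more.\<close>

lemma symmetric_vector_induct:
  fixes P :: "(nat \<Rightarrow> bit) \<Rightarrow> bool"
  assumes one: "P (\<lambda>_. 1)"
    and add: "\<And>f g. P f \<Longrightarrow> P g \<Longrightarrow> P (\<lambda>r. f r + g r)"
    and J: "\<And>f. P f \<Longrightarrow> P (matrix_vec {1..m} (J_matrix m) f)"
    and cong: "\<And>f g. P f \<Longrightarrow> (\<And>r. r \<in> {1..m} \<Longrightarrow> f r = g r) \<Longrightarrow> P g"
    and sym: "\<And>r. r \<in> {1..m} \<Longrightarrow> f r = f (m + 1 - r)"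
  shows "P f"
proof -
  define g :: "nat \<Rightarrow> nat \<Rightarrow> bit"
    where "g j r = of_bool (r = j) + of_bool (r + j = m + 1)" for j r
  have zero: "P (\<lambda>_. 0)"
    using add[OF one one] by simp
  have const: "P (\<lambda>_. c)" for c
    using zero one by (cases c) simp_all
  \<comment> \<open>Two consecutive indices are carried along because the recurrence refers back two
    steps.\<close>
  have g_ind: "j \<le> m \<longrightarrow> P (g j) \<and> (j + 1 \<le> m \<longrightarrow> P (g (j + 1)))" for j
  proof (induction j)
    case 0
    have "P (g 0)"
      by (rule cong[OF zero]) (auto simp: g_def)
    \<comment> \<open>The two neighbours of an inner index cancel, so \<open>J\<close> leaves ones
      only at the ends; for \<open>m = 1\<close> both sides vanish.\<close>
    moreover have "P (g 1)"
      by (rule cong[OF J[OF one]]) (subst matrix_vec_J_matrix, auto simp: g_def)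
    ultimately show ?case by simp
  next
    case (Suc j)
    show ?case
    proof (intro impI conjI)
      assume "Suc j \<le> m"
      then show "P (g (Suc j))" using Suc by simp
      assume j: "Suc j + 1 \<le> m"
      have "P (\<lambda>r. matrix_vec {1..m} (J_matrix m) (g (j + 1)) r + g j r)"
        using Suc j by (intro add J) simp_all
      then show "P (g (Suc j + 1))"
      proof (rule cong)
        fix r assume r: "r \<in> {1..m}"
        then show "matrix_vec {1..m} (J_matrix m) (g (j + 1)) r + g j r = g (Suc j + 1) r"
          using j by (subst matrix_vec_J_matrix) (auto simp: g_def)
      qed
    qed
  qed
  have gP: "P (g j)" if "j \<le> m" for j
    using g_ind that by blast
  \<comment> \<open>Adding \<open>c\<close> makes \<open>f\<close> vanish at the middle index of an
    odd \<open>m\<close>, where all \<open>g j\<close> are 0.\<close>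
  define c where "c = (if odd m then f ((m + 1) div 2) else 0)"
  have sum_P: "P (\<lambda>r. \<Sum>j\<in>A. (f j + c) * g j r)" if "finite A" "A \<subseteq> {1..m}" for A
    using that
  proof (induction A rule: finite_induct)
    case (insert a A)
    have "P (\<lambda>r. (f a + c) * g a r)"
      using zero gP[of a] insert.prems by (cases "f a + c") simp_all
    with insert show ?case by (simp add: add)
  qed (simp add: zero)
  have "P (\<lambda>r. (\<Sum>j\<in>{1..m div 2}. (f j + c) * g j r) + c)"
    by (intro add const sum_P) auto
  then show ?thesis
  proof (rule cong)
    fix r assume r: "r \<in> {1..m}"
    have "(\<Sum>j\<in>{1..m div 2}. (f j + c) * g j r) =
          (\<Sum>j\<in>{1..m div 2}. if j = r then f j + c else 0) +
          (\<Sum>j\<in>{1..m div 2}. if j = m + 1 - r then f j + c else 0)"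
      unfolding sum.distrib[symmetric] using r
      by (intro sum.cong) (auto simp: g_def)
    also have "\<dots> = (if r \<le> m div 2 then f r + c else 0) +
          (if m + 1 - r \<le> m div 2 then f r + c else 0)"
      using r sym[OF r] by auto
    also have "\<dots> = f r + c"
    \<comment> \<open>Exactly one of \<open>r\<close> and \<open>m + 1 - r\<close> lies in the lower
      half, unless \<open>r\<close> is the middle index, where \<open>f r + c = 0\<close>.\<close>
    proof (cases "r \<le> m div 2 \<or> m + 1 - r \<le> m div 2")
      case True
      moreover have "\<not> (r \<le> m div 2 \<and> m + 1 - r \<le> m div 2)" by linarith
      ultimately show ?thesis by auto
    next
      case False
      then have "r = (m + 1) div 2" "odd m"
        using r by (simp_all only: atLeastAtMost_iff) presburger+
      then show ?thesis using False by (simp add: c_def)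
    qed
    finally show "(\<Sum>j\<in>{1..m div 2}. (f j + c) * g j r) + c = f r"
      by (simp add: add.assoc)
  qed
qed

section \<open>Completely symmetric configurations on the grid\<close>

text \<open>By induction on a set \<open>K\<close> of coordinates on which \<open>y\<close> depends: for \<open>i \<in> K\<close>, write \<open>y u\<close>
  as a sum over \<open>j\<close> of a symmetric function of \<open>u i\<close> times \<open>y (u(i := j))\<close>. The latter depends on
  \<open>K - {i}\<close> only, so that \<open>J\<^sub>i\<close> acts on the first factor alone.\<close>

lemma completely_symmetric_mem:
  fixes W :: "((nat \<Rightarrow> nat) \<Rightarrow> bit) set" and n :: "nat \<Rightarrow> nat" and d :: nat
  defines "G \<equiv> grid d n"
  assumes one: "(\<lambda>_\<in>G. 1) \<in> W"
    and add: "\<And>x y. restrict x G \<in> W \<Longrightarrow> restrict y G \<in> W \<Longrightarrow> (\<lambda>v\<in>G. x v + y v) \<in> W"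
    and J: "\<And>i x. i \<in> {1..d} \<Longrightarrow> x \<in> W \<Longrightarrow> matrix_vec G (J_factor d n i) x \<in> W"
    and n: "\<forall>i\<in>{1..d}. n i \<ge> 1"
    and y: "completely_symmetric d n y"
  shows "restrict y G \<in> W"
proof -
  have zero: "(\<lambda>_\<in>G. 0) \<in> W"
    using add[OF one one] by simp
  have slice: "(\<lambda>u\<in>G. f (u i) * h u) \<in> W"
    if i: "i \<in> {1..d}" and h: "restrict h G \<in> W"
      and hi: "\<And>u r. u \<in> G \<Longrightarrow> r \<in> {1..n i} \<Longrightarrow> h (u(i := r)) = h u"
      and f: "\<And>r. r \<in> {1..n i} \<Longrightarrow> f r = f (n i + 1 - r)"
    for i h and f :: "nat \<Rightarrow> bit"
  proof (rule symmetric_vector_induct[where P = "\<lambda>f. (\<lambda>u\<in>G. f (u i) * h u) \<in> W"])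
    fix f assume "(\<lambda>u\<in>G. f (u i) * h u) \<in> W"
    from J[OF i this] have "matrix_vec G (J_factor d n i) (\<lambda>u\<in>G. f (u i) * h u) \<in> W" .
    also have "matrix_vec G (J_factor d n i) (\<lambda>u\<in>G. f (u i) * h u) =
        (\<lambda>u\<in>G. matrix_vec {1..n i} (J_matrix (n i)) f (u i) * h u)"
    proof (rule extensionalityI[of _ G])
      fix u assume u: "u \<in> G"
      have "matrix_vec G (J_factor d n i) (\<lambda>u\<in>G. f (u i) * h u) u =
        (\<Sum>r\<in>{1..n i}. J_matrix (n i) (u i) r * (f r * h u))"
        using u i hi[OF u] grid_upd[of u d n i] unfolding G_def
        by (subst matrix_vec_J_factor) (auto intro!: sum.cong)
      then show "matrix_vec G (J_factor d n i) (\<lambda>u\<in>G. f (u i) * h u) u =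
        (\<lambda>u\<in>G. matrix_vec {1..n i} (J_matrix (n i)) f (u i) * h u) u"
        using u i grid_coord[of u d n i] unfolding G_def
        by (simp add: matrix_vec_def sum_distrib_right mult.assoc)
    qed (auto simp: matrix_vec_def)
    finally show "(\<lambda>u\<in>G. matrix_vec {1..n i} (J_matrix (n i)) f (u i) * h u) \<in> W" .
  next
    fix f g :: "nat \<Rightarrow> bit" assume "(\<lambda>u\<in>G. f (u i) * h u) \<in> W" "\<And>r. r \<in> {1..n i} \<Longrightarrow> f r = g r"
    moreover from this(2) have "(\<lambda>u\<in>G. f (u i) * h u) = (\<lambda>u\<in>G. g (u i) * h u)"
      using grid_coord[of _ d n i] i unfolding G_def by (intro restrict_ext) auto
    ultimately show "(\<lambda>u\<in>G. g (u i) * h u) \<in> W" by simp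
  next
    fix f g :: "nat \<Rightarrow> bit"
    assume "(\<lambda>u\<in>G. f (u i) * h u) \<in> W" "(\<lambda>u\<in>G. g (u i) * h u) \<in> W"
    then show "(\<lambda>u\<in>G. (f (u i) + g (u i)) * h u) \<in> W"
      unfolding distrib_right by (rule add)
  next
    show "(\<lambda>u\<in>G. 1 * h u) \<in> W"
      unfolding mult_1 by (rule h)
  qed (rule f)
  have "restrict y G \<in> W"
    if "finite K" "K \<subseteq> {1..d}" "completely_symmetric d n y"
      and "\<And>u v. u \<in> G \<Longrightarrow> v \<in> G \<Longrightarrow> (\<And>i. i \<in> K \<Longrightarrow> u i = v i) \<Longrightarrow> y u = y v" for K y
    using that
  proof (induction K arbitrary: y rule: finite_induct)
    case empty
    show ?case
    \<comment> \<open>Depending on no coordinate, \<open>y\<close> is constant on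
      \<open>G\<close>.\<close>
    proof (cases "\<exists>u\<in>G. y u = 1")
      case True
      with empty have "restrict y G = (\<lambda>_\<in>G. 1)"
        by (intro restrict_ext) (metis empty_iff)
      with one show ?thesis by argo
    next
      case False
      then have "restrict y G = (\<lambda>_\<in>G. 0)"
        by (intro restrict_ext) auto
      with zero show ?thesis by argo
    qed
  next
    case (insert i K)
    \<comment> \<open>Rounding up keeps the middle index of an odd \<open>n i\<close> among the
      representatives \<open>{1..m}\<close>.\<close>
    define m where "m = (n i + 1) div 2"
    have i: "i \<in> {1..d}" using insert.prems by auto
    have ni: "1 \<le> n i" using n i by blast
    \<comment> \<open>A disjunction, not a sum of two unit vectors: at the middle index
      \<open>f j\<close> must be 1, where the sum would be 0.\<close>
    define f :: "nat \<Rightarrow> nat \<Rightarrow> bit" where "f j r = of_bool (r = j \<or> r = n i + 1 - j)" for j r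
    have term_mem: "(\<lambda>u\<in>G. f j (u i) * y (u(i := j))) \<in> W" if j: "j \<in> {1..m}" for j
    proof (rule slice[OF i])
      have jn: "j \<in> {1..n i}" using j ni by (auto simp: m_def)
      have upd: "u(i := j) \<in> G" if "u \<in> G" for u
        using that i jn unfolding G_def by (rule grid_upd)
      show "(\<lambda>u\<in>G. y (u(i := j))) \<in> W"
      proof (rule insert.IH)
        show "completely_symmetric d n (\<lambda>u. y (u(i := j)))"
          unfolding completely_symmetric_def
        proof (intro ballI)
          fix k u assume k: "k \<in> {1..d}" and u: "u \<in> grid d n"
          show "y (u(i := j)) = y ((u(k := n k + 1 - u k))(i := j))"
          proof (cases "k = i")
            case False
            then have "y ((u(i := j))(k := n k + 1 - u k)) = y (u(i := j))"
              using insert.prems(2) k upd[of u] u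
              unfolding completely_symmetric_def G_def by fastforce
            with False show ?thesis by (simp add: fun_upd_twist)
          qed simp
        qed
      next
        fix u v assume "u \<in> G" "v \<in> G" "\<And>k. k \<in> K \<Longrightarrow> u k = v k"
        then show "y (u(i := j)) = y (v(i := j))"
          by (intro insert.prems(3) upd) auto
      qed (use insert.prems in auto)
      show "f j r = f j (n i + 1 - r)" if "r \<in> {1..n i}" for r
        using that jn by (auto simp: f_def)
    qed (simp only: fun_upd_upd)
    have "(\<lambda>u\<in>G. \<Sum>j\<in>A. f j (u i) * y (u(i := j))) \<in> W" if "finite A" "A \<subseteq> {1..m}" for A
      using that
    proof (induction A rule: finite_induct)
      case empty
      show ?case unfolding sum.empty by (rule zero)
    next
      case (insert a A)
      from insert.prems have a: "a \<in> {1..m}" and A: "A \<subseteq> {1..m}" by auto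
      show ?case
        unfolding sum.insert[OF insert.hyps] by (intro add term_mem a insert.IH A)
    qed
    then have "(\<lambda>u\<in>G. \<Sum>j\<in>{1..m}. f j (u i) * y (u(i := j))) \<in> W" by simp
    also have "(\<lambda>u\<in>G. \<Sum>j\<in>{1..m}. f j (u i) * y (u(i := j))) = restrict y G"
    proof (rule restrict_ext)
      fix u assume u: "u \<in> G"
      \<comment> \<open>The representative of \<open>u i\<close> under reflection, and the only
        \<open>j\<close> in \<open>{1..m}\<close> with \<open>f j (u i) = 1\<close>; complete
        symmetry of \<open>y\<close> lets it replace \<open>u i\<close>.\<close>
      define a where "a = min (u i) (n i + 1 - u i)"
      have ui: "u i \<in> {1..n i}" using grid_coord u i by (simp add: G_def)
      then have a: "a \<in> {1..m}" by (auto simp: a_def m_def)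
      have "(\<Sum>j\<in>{1..m}. f j (u i) * y (u(i := j))) =
        (\<Sum>j\<in>{1..m}. if j = a then y (u(i := j)) else 0)"
        using ui by (intro sum.cong) (auto simp: f_def a_def m_def min_def)
      also have "\<dots> = y (u(i := a))" using a by simp
      also have "\<dots> = y u"
        using insert.prems(2) i u
        unfolding completely_symmetric_def G_def a_def min_def by auto
      finally show "(\<Sum>j\<in>{1..m}. f j (u i) * y (u(i := j))) = y u" .
    qed
    finally show ?case .
  qed
  \<comment> \<open>A point of the grid is determined by its coordinates in \<open>{1..d}\<close>,
    so \<open>K = {1..d}\<close> is admissible for every \<open>y\<close>.\<close>
  moreover have "y u = y v" if "u \<in> G" "v \<in> G" "\<And>i. i \<in> {1..d} \<Longrightarrow> u i = v i" for u v
    using PiE_ext[OF that[unfolded G_def grid_def]] by (rule arg_cong)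
  ultimately show ?thesis
    using y by (metis finite_atLeastAtMost order_refl)
qed

theorem theorem3:
  fixes d :: nat
    and n :: "nat \<Rightarrow> nat"
    and M :: "(nat \<Rightarrow> nat) bit_matrix"
    and y :: "(nat \<Rightarrow> nat) \<Rightarrow> bit"
  assumes "d \<ge> 1"
    and "\<forall>i\<in>{1..d}. n i \<ge> 1"
    and "symmetric_on (grid d n) M"
    and "\<forall>v\<in>grid d n. M v v = 1"
    and "\<forall>i\<in>{1..d}. commute_on (grid d n) M (J_factor d n i)"
    and "y \<in> configurations (grid d n)"
    and "completely_symmetric d n y"
  shows "y \<in> matrix_image (grid d n) M \<and> y \<in> achievable (grid d n) M"
proof -
  let ?G = "grid d n"
  obtain x where "\<forall>u\<in>?G. (\<Sum>w\<in>?G. M u w * x w) = 1"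
    using all_ones_solvable[OF finite_grid assms(3,4)] by blast
  then have "matrix_vec ?G M x = (\<lambda>_\<in>?G. 1)"
    unfolding matrix_vec_def by (intro restrict_ext) simp
  then have one: "(\<lambda>_\<in>?G. 1) \<in> matrix_image ?G M"
    by (metis matrix_vec_in_image)
  have "restrict y ?G \<in> matrix_image ?G M"
  proof (rule completely_symmetric_mem)
    show "matrix_vec ?G (J_factor d n i) x \<in> matrix_image ?G M"
      if "i \<in> {1..d}" "x \<in> matrix_image ?G M" for i x
      using assms(5) that by (blast intro: matrix_image_commute)
  qed (fact one matrix_image_add assms)+
  moreover have "restrict y ?G = y"
    using assms(6) by (simp add: configurations_def PiE_restrict)
  ultimately show ?thesis
    using matrix_image_subset_achievable[OF finite_grid, of d n M] by auto
qed

end
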